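(* Let $S$ be a completely regular semigroup and let $\rho$ be an orthodox congruence on $S$. The following statements are equivalent. (1) $\ker\rho$ is cryptic; (2) $\ker\rho\subseteq\ker\mu$; (3) $\rho\cap\mathcal{H}=\rho\cap\mu$; (4) $\rho\cap\mathcal{H}$ is a congruence on $S$; (5) $\rho_k\subseteq\mu$; (6) $(\rho_k)_t=\varepsilon$; (7) $\rho_k\cap\Theta=\varepsilon$; (8) $\rho_k$ is over groups.
   Context: A completely regular semigroup is a semigroup that is a union of its subgroups; for $a\in S$, $a^{-1}$ is the inverse of $a$ in the maximal subgroup containing $a$, and $a^0=aa^{-1}=a^{-1}a$. $E(S)$ is the set of idempotents of $S$, $\mathcal{H}$ is Green's relation, and $\varepsilon$ is the equality relation. A regular semigroup is orthodox if its idempotents form a subsemigroup; a congruence $\rho$ on $S$ is orthodox if $S/\rho$ is orthodox. A semigroup is cryptic if its Green's relation $\mathcal{H}$ is a congruence on it. For a congruence $\rho$ on $S$: $\operatorname{tr}\rho=\rho|_{E(S)}$ (trace) and $\ker\rho=\{a\in S: a\,\rho\,e \text{ for some } e\in E(S)\}$ (kernel); $\rho_k$ denotes the least congruence on $S$ with the same kernel as $\rho$, and $\rho_t$ the least congruence on $S$ with the same trace as $\rho$ (both exist). For an orthodox congruence $\rho$, $\ker\rho$ is a completely regular subsemigroup of $S$, and "$\ker\rho$ is cryptic" refers to Green's relation $\mathcal H$ of the semigroup $\ker\rho$. A congruence is idempotent separating if any two idempotents related by it are equal; $\mu$ is the greatest idempotent separating congruence on $S$. The relation $\Theta$ on $S$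 is defined by $a\,\Theta\,b\iff a^0b=ab^0$. A congruence is over a class $\mathcal{A}$ of semigroups (e.g. over groups) if each of its classes that is a subsemigroup of $S$ belongs to $\mathcal{A}$. *)

theory Defs
  imports "HOL-Algebra.Group"
begin

text \<open>
  A semigroup is a carrier set \<open>S\<close> with an operation \<open>m\<close>. The operation is only constrained on \<open>S\<close>,
  so that subsemigroups and quotients of a semigroup are again of this form. The empty carrier is
  not excluded.
\<close>

definition semigroup_on :: "'a set \<Rightarrow> ('a \<Rightarrow> 'a \<Rightarrow> 'a) \<Rightarrow> bool" where
  "semigroup_on S m \<longleftrightarrow>
     (\<forall>x\<in>S. \<forall>y\<in>S. m x y \<in> S) \<and>
     (\<forall>x\<in>S. \<forall>y\<in>S. \<forall>z\<in>S. m (m x y) z = m x (m y z))"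

definition subsemigroup_of :: "'a set \<Rightarrow> 'a set \<Rightarrow> ('a \<Rightarrow> 'a \<Rightarrow> 'a) \<Rightarrow> bool" where
  "subsemigroup_of T S m \<longleftrightarrow> T \<noteq> {} \<and> T \<subseteq> S \<and> (\<forall>x\<in>T. \<forall>y\<in>T. m x y \<in> T)"

definition is_group_on :: "'a set \<Rightarrow> ('a \<Rightarrow> 'a \<Rightarrow> 'a) \<Rightarrow> bool" where
  "is_group_on G m \<longleftrightarrow> (\<exists>e. group \<lparr>carrier = G, monoid.mult = m, one = e\<rparr>)"

definition subgroup_of :: "'a set \<Rightarrow> 'a set \<Rightarrow> ('a \<Rightarrow> 'a \<Rightarrow> 'a) \<Rightarrow> bool" where
  "subgroup_of G S m \<longleftrightarrow> G \<subseteq> S \<and> is_group_on G m"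

definition maximal_subgroup_of :: "'a set \<Rightarrow> 'a set \<Rightarrow> ('a \<Rightarrow> 'a \<Rightarrow> 'a) \<Rightarrow> bool" where
  "maximal_subgroup_of G S m \<longleftrightarrow>
     subgroup_of G S m \<and> (\<forall>K. subgroup_of K S m \<and> G \<subseteq> K \<longrightarrow> K = G)"

definition completely_regular :: "'a set \<Rightarrow> ('a \<Rightarrow> 'a \<Rightarrow> 'a) \<Rightarrow> bool" where
  "completely_regular S m \<longleftrightarrow> semigroup_on S m \<and> S = \<Union>{G. subgroup_of G S m}"

text \<open>
  In a completely regular semigroup each element lies in exactly one maximal subgroup, and the
  identity of that group is unique, so the description below denotes.
\<close>

definition cr_inverse :: "'a set \<Rightarrow> ('a \<Rightarrow> 'a \<Rightarrow> 'a) \<Rightarrow> 'a \<Rightarrow> 'a" where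
  "cr_inverse S m a =
     (THE b. \<exists>G e. maximal_subgroup_of G S m \<and> a \<in> G \<and>
        group \<lparr>carrier = G, monoid.mult = m, one = e\<rparr> \<and>
        b = inv\<^bsub>\<lparr>carrier = G, monoid.mult = m, one = e\<rparr>\<^esub> a)"

definition cr_zero :: "'a set \<Rightarrow> ('a \<Rightarrow> 'a \<Rightarrow> 'a) \<Rightarrow> 'a \<Rightarrow> 'a" where
  "cr_zero S m a = m a (cr_inverse S m a)"

definition idempotents :: "'a set \<Rightarrow> ('a \<Rightarrow> 'a \<Rightarrow> 'a) \<Rightarrow> 'a set" where
  "idempotents S m = {e \<in> S. m e e = e}"

text \<open>
  Green's relations compare the principal one-sided ideals generated in \<open>S\<close> with an identity
  adjoined, hence the \<open>insert\<close>.
\<close>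

definition green_L :: "'a set \<Rightarrow> ('a \<Rightarrow> 'a \<Rightarrow> 'a) \<Rightarrow> ('a \<times> 'a) set" where
  "green_L S m = {(a, b) \<in> S \<times> S. insert a ((\<lambda>x. m x a) ` S) = insert b ((\<lambda>x. m x b) ` S)}"

definition green_R :: "'a set \<Rightarrow> ('a \<Rightarrow> 'a \<Rightarrow> 'a) \<Rightarrow> ('a \<times> 'a) set" where
  "green_R S m = {(a, b) \<in> S \<times> S. insert a ((\<lambda>x. m a x) ` S) = insert b ((\<lambda>x. m b x) ` S)}"

definition green_H :: "'a set \<Rightarrow> ('a \<Rightarrow> 'a \<Rightarrow> 'a) \<Rightarrow> ('a \<times> 'a) set" where
  "green_H S m = green_L S m \<inter> green_R S m"

definition congruence_on :: "'a set \<Rightarrow> ('a \<Rightarrow> 'a \<Rightarrow> 'a) \<Rightarrow> ('a \<times> 'a) set \<Rightarrow> bool" where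
  "congruence_on S m \<rho> \<longleftrightarrow>
     equiv S \<rho> \<and> (\<forall>a b c d. (a, b) \<in> \<rho> \<and> (c, d) \<in> \<rho> \<longrightarrow> (m a c, m b d) \<in> \<rho>)"

definition quotient_mult ::
  "('a \<Rightarrow> 'a \<Rightarrow> 'a) \<Rightarrow> ('a \<times> 'a) set \<Rightarrow> 'a set \<Rightarrow> 'a set \<Rightarrow> 'a set" where
  "quotient_mult m \<rho> X Y = (\<Union>x\<in>X. \<Union>y\<in>Y. \<rho> `` {m x y})"

definition regular_semigroup :: "'a set \<Rightarrow> ('a \<Rightarrow> 'a \<Rightarrow> 'a) \<Rightarrow> bool" where
  "regular_semigroup S m \<longleftrightarrow> semigroup_on S m \<and> (\<forall>a\<in>S. \<exists>x\<in>S. m (m a x) a = a)"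

definition orthodox :: "'a set \<Rightarrow> ('a \<Rightarrow> 'a \<Rightarrow> 'a) \<Rightarrow> bool" where
  "orthodox S m \<longleftrightarrow> regular_semigroup S m \<and>
     (\<forall>e\<in>idempotents S m. \<forall>f\<in>idempotents S m. m e f \<in> idempotents S m)"

definition orthodox_congruence :: "'a set \<Rightarrow> ('a \<Rightarrow> 'a \<Rightarrow> 'a) \<Rightarrow> ('a \<times> 'a) set \<Rightarrow> bool" where
  "orthodox_congruence S m \<rho> \<longleftrightarrow>
     congruence_on S m \<rho> \<and> orthodox (S // \<rho>) (quotient_mult m \<rho>)"

definition cryptic :: "'a set \<Rightarrow> ('a \<Rightarrow> 'a \<Rightarrow> 'a) \<Rightarrow> bool" where
  "cryptic S m \<longleftrightarrow> congruence_on S m (green_H S m)"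

definition tr :: "'a set \<Rightarrow> ('a \<Rightarrow> 'a \<Rightarrow> 'a) \<Rightarrow> ('a \<times> 'a) set \<Rightarrow> ('a \<times> 'a) set" where
  "tr S m \<rho> = \<rho> \<inter> (idempotents S m \<times> idempotents S m)"

definition ker :: "'a set \<Rightarrow> ('a \<Rightarrow> 'a \<Rightarrow> 'a) \<Rightarrow> ('a \<times> 'a) set \<Rightarrow> 'a set" where
  "ker S m \<rho> = {a \<in> S. \<exists>e\<in>idempotents S m. (a, e) \<in> \<rho>}"

text \<open>
  Least and greatest are taken with respect to inclusion. On a completely regular semigroup the
  three congruences defined next exist.
\<close>

definition least_same_ker ::
  "'a set \<Rightarrow> ('a \<Rightarrow> 'a \<Rightarrow> 'a) \<Rightarrow> ('a \<times> 'a) set \<Rightarrow> ('a \<times> 'a) set" where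
  "least_same_ker S m \<rho> = (LEAST \<sigma>. congruence_on S m \<sigma> \<and> ker S m \<sigma> = ker S m \<rho>)"

definition least_same_tr ::
  "'a set \<Rightarrow> ('a \<Rightarrow> 'a \<Rightarrow> 'a) \<Rightarrow> ('a \<times> 'a) set \<Rightarrow> ('a \<times> 'a) set" where
  "least_same_tr S m \<rho> = (LEAST \<sigma>. congruence_on S m \<sigma> \<and> tr S m \<sigma> = tr S m \<rho>)"

definition idempotent_separating :: "'a set \<Rightarrow> ('a \<Rightarrow> 'a \<Rightarrow> 'a) \<Rightarrow> ('a \<times> 'a) set \<Rightarrow> bool" where
  "idempotent_separating S m \<rho> \<longleftrightarrow>
     (\<forall>e\<in>idempotents S m. \<forall>f\<in>idempotents S m. (e, f) \<in> \<rho> \<longrightarrow> e = f)"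

definition greatest_idem_sep :: "'a set \<Rightarrow> ('a \<Rightarrow> 'a \<Rightarrow> 'a) \<Rightarrow> ('a \<times> 'a) set" where
  "greatest_idem_sep S m = (GREATEST \<sigma>. congruence_on S m \<sigma> \<and> idempotent_separating S m \<sigma>)"

definition Theta :: "'a set \<Rightarrow> ('a \<Rightarrow> 'a \<Rightarrow> 'a) \<Rightarrow> ('a \<times> 'a) set" where
  "Theta S m = {(a, b) \<in> S \<times> S. m (cr_zero S m a) b = m a (cr_zero S m b)}"

definition over_groups :: "'a set \<Rightarrow> ('a \<Rightarrow> 'a \<Rightarrow> 'a) \<Rightarrow> ('a \<times> 'a) set \<Rightarrow> bool" where
  "over_groups S m \<rho> \<longleftrightarrow> (\<forall>C \<in> S // \<rho>. subsemigroup_of C S m \<longrightarrow> is_group_on C m)"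

end

theory Submission imports Defs begin

text \<open>
  On a completely regular semigroup \<open>a \<H> b\<close> iff \<open>a\<^sup>0 = b\<^sup>0\<close>, and a congruence is idempotent separating
  iff it lies in \<open>\<H>\<close>. Hence (5)--(8) all say that \<open>\<rho>\<^sub>k\<close> is idempotent separating, and
  since \<open>\<rho> \<inter> \<mu>\<close> has kernel \<open>ker \<rho> \<inter> ker \<mu>\<close>, this amounts to (2). For (2) to (3), \<open>a\<close> and \<open>b\<close>
  related by \<open>\<rho> \<inter> \<H>\<close> give \<open>a b\<^sup>-\<^sup>1 \<in> ker \<rho>\<close>, so that \<open>a b\<^sup>-\<^sup>1\<close> is \<open>\<mu>\<close>-related to \<open>b\<^sup>0\<close>. The main step is
  (1) to (4): with \<open>c = a b\<^sup>-\<^sup>1\<close>, crypticity of \<open>ker \<rho>\<close> gives \<open>x\<^sup>0 c \<H> x\<^sup>0 b\<^sup>0\<close>, and \<open>\<L>\<close> being a right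
  congruence turns this into \<open>x c \<L> x b\<^sup>0\<close> and then \<open>x a \<L> x b\<close>; \<open>x a \<R> x b\<close> is automatic.
\<close>

section \<open>Congruences on a carrier set and products of their classes\<close>

text \<open>Translations on one side at a time suffice: \<open>m a c\<close> is related to
  \<open>m b c\<close>, and this to \<open>m b d\<close>.\<close>

lemma congruence_onI:
  assumes "equiv S \<sigma>"
    and clos: "\<And>x y. x \<in> S \<Longrightarrow> y \<in> S \<Longrightarrow> m x y \<in> S"
    and left: "\<And>x a b. x \<in> S \<Longrightarrow> (a, b) \<in> \<sigma> \<Longrightarrow> (m x a, m x b) \<in> \<sigma>"
    and right: "\<And>x a b. x \<in> S \<Longrightarrow> (a, b) \<in> \<sigma> \<Longrightarrow> (m a x, m b x) \<in> \<sigma>"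
  shows "congruence_on S m \<sigma>"
proof -
  have sub: "\<sigma> \<subseteq> S \<times> S" and "trans \<sigma>"
    using assms(1) by (auto simp: equiv_def)
  have "(m a c, m b d) \<in> \<sigma>" if "(a, b) \<in> \<sigma>" "(c, d) \<in> \<sigma>" for a b c d
    using that left[of b c d] right[of c a b] sub transD[OF \<open>trans \<sigma>\<close>] by blast
  then show ?thesis
    using assms(1) by (auto simp: congruence_on_def)
qed

text \<open>Least congruences with a given kernel or trace arise as such intersections;
  \<open>C \<noteq> {}\<close> keeps the intersection inside \<open>S \<times> S\<close>.\<close>

lemma congruence_on_Inter:
  assumes "\<And>\<sigma>. \<sigma> \<in> C \<Longrightarrow> congruence_on S m \<sigma>" and "C \<noteq> {}"
  shows "congruence_on S m (\<Inter>C)"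
proof -
  have e: "equiv S \<sigma>" if "\<sigma> \<in> C" for \<sigma>
    using assms(1)[OF that] by (simp add: congruence_on_def)
  have "equiv S (\<Inter>C)"
  proof (rule equivI)
    show "\<Inter>C \<subseteq> S \<times> S" using e assms(2) by (fastforce simp: equiv_def)
    show "refl_on S (\<Inter>C)" using e by (auto simp: equiv_def refl_on_def)
    show "sym (\<Inter>C)" using e by (auto simp: equiv_def sym_def)
    show "trans (\<Inter>C)"
      by (rule transI) (meson InterE InterI e equiv_def transD)
  qed
  then show ?thesis
    using assms(1) by (fastforce simp: congruence_on_def)
qed

lemma congruence_on_Int:
  assumes "congruence_on S m \<sigma>" "congruence_on S m \<tau>"
  shows "congruence_on S m (\<sigma> \<inter> \<tau>)"
  using congruence_on_Inter[of "{\<sigma>, \<tau>}" S m] assms by auto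

lemma congruence_on_Id_on:
  assumes "semigroup_on S m"
  shows "congruence_on S m (Id_on S)"
  using assms by (auto simp: congruence_on_def semigroup_on_def intro!: equivI refl_onI symI transI)

text \<open>All products of representatives lie in one class, so the union defining
  \<open>quotient_mult\<close> collapses; reflexivity makes it a union over nonempty sets.\<close>

lemma quotient_mult_classes:
  assumes "congruence_on S m \<sigma>" "a \<in> S" "b \<in> S"
  shows "quotient_mult m \<sigma> (\<sigma> `` {a}) (\<sigma> `` {b}) = \<sigma> `` {m a b}"
proof -
  have eq: "equiv S \<sigma>" and c: "\<And>a b c d. (a, b) \<in> \<sigma> \<Longrightarrow> (c, d) \<in> \<sigma> \<Longrightarrow> (m a c, m b d) \<in> \<sigma>"
    using assms(1) by (auto simp: congruence_on_def)
  have "\<sigma> `` {m x y} = \<sigma> `` {m a b}" if "(a, x) \<in> \<sigma>" "(b, y) \<in> \<sigma>" for x y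
    using equiv_class_eq[OF eq c[OF that]] by simp
  moreover have "(a, a) \<in> \<sigma>" "(b, b) \<in> \<sigma>"
    using eq assms by (auto simp: equiv_def refl_on_def)
  ultimately show ?thesis
    unfolding quotient_mult_def by blast
qed

section \<open>Completely regular semigroups as semigroups with a unary operation\<close>

text \<open>A commuting inverse \<open>iv\<close> replaces the maximal subgroups. It is a parameter,
  so that one and the same operation serves \<open>S\<close> and, later,
  \<open>ker S m \<rho>\<close>.\<close>

locale cr_semigroup =
  fixes S :: "'a set" and m :: "'a \<Rightarrow> 'a \<Rightarrow> 'a" (infixl "\<cdot>" 70) and iv :: "'a \<Rightarrow> 'a"
  assumes closed [simp]: "x \<in> S \<Longrightarrow> y \<in> S \<Longrightarrow> x \<cdot> y \<in> S"
    and assoc: "x \<in> S \<Longrightarrow> y \<in> S \<Longrightarrow> z \<in> S \<Longrightarrow> x \<cdot> y \<cdot> z = x \<cdot> (y \<cdot> z)"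
    and iv_closed [simp]: "x \<in> S \<Longrightarrow> iv x \<in> S"
    and m_iv_m: "x \<in> S \<Longrightarrow> x \<cdot> iv x \<cdot> x = x"
    and iv_m_iv: "x \<in> S \<Longrightarrow> iv x \<cdot> x \<cdot> iv x = iv x"
    and iv_comm: "x \<in> S \<Longrightarrow> iv x \<cdot> x = x \<cdot> iv x"
begin

text \<open>The idempotent written \<open>x\<^sup>0\<close> in the paper.\<close>

definition z :: "'a \<Rightarrow> 'a" where "z x = x \<cdot> iv x"

lemma z_closed [simp]: "x \<in> S \<Longrightarrow> z x \<in> S"
  by (simp add: z_def)

lemma iv_m [simp]: "x \<in> S \<Longrightarrow> iv x \<cdot> x = z x"
  by (simp add: z_def iv_comm)

lemma m_iv [simp]: "x \<cdot> iv x = z x"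
  by (simp add: z_def)

lemma z_m [simp]: "x \<in> S \<Longrightarrow> z x \<cdot> x = x"
  by (simp add: z_def m_iv_m del: m_iv)

lemma m_z [simp]: "x \<in> S \<Longrightarrow> x \<cdot> z x = x"
  by (metis assoc iv_closed iv_m m_iv z_m)

lemma z_iv [simp]: "x \<in> S \<Longrightarrow> z x \<cdot> iv x = iv x"
  by (metis iv_m iv_m_iv)

lemma iv_z [simp]: "x \<in> S \<Longrightarrow> iv x \<cdot> z x = iv x"
  by (metis assoc iv_closed iv_m m_iv z_iv)

lemma z_z [simp]: "x \<in> S \<Longrightarrow> z x \<cdot> z x = z x"
  by (metis assoc iv_closed m_iv z_closed z_m)

lemma z_idempotents: "x \<in> S \<Longrightarrow> z x \<in> idempotents S m"
  by (simp add: idempotents_def)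

text \<open>The product \<open>z x \<cdot> e\<close> has two values: it is \<open>z x\<close>
  because \<open>x \<cdot> e = x\<close>, and \<open>e\<close> because
  \<open>e = x \<cdot> y\<close> and \<open>z x \<cdot> x = x\<close>. This computes
  \<open>z x\<close> without computing \<open>iv x\<close>.\<close>

lemma z_unique:
  assumes "x \<in> S" "e \<in> S" "y \<in> S" "e \<cdot> x = x" "x \<cdot> y = e" "e = y \<cdot> x" "x \<cdot> e = x"
  shows "z x = e"
proof -
  have "z x = z x \<cdot> e"
    by (metis assms assoc iv_closed iv_m)
  also have "\<dots> = e"
    using assms by (metis assoc z_closed z_m)
  finally show ?thesis .
qed

lemma z_idem:
  assumes "e \<in> idempotents S m" shows "z e = e"
  using assms z_unique[of e e e] by (simp add: idempotents_def)

lemma z_iv_eq: "x \<in> S \<Longrightarrow> z (iv x) = z x"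
  by (rule z_unique[where y = x]) auto

text \<open>Elements with the same \<open>z\<close> lie in one group with identity
  \<open>z b\<close>, and there \<open>b \<cdot> iv a\<close> inverts
  \<open>a \<cdot> iv b\<close>.\<close>

lemma z_m_iv:
  assumes "a \<in> S" "b \<in> S" "z a = z b"
  shows "z (a \<cdot> iv b) = z b"
proof (rule z_unique[where y = "b \<cdot> iv a"])
  have "z b \<cdot> a = a" using assms by (metis z_m)
  then show "z b \<cdot> (a \<cdot> iv b) = a \<cdot> iv b" using assms by (metis assoc iv_closed z_closed)
  have "a \<cdot> iv b \<cdot> (b \<cdot> iv a) = a \<cdot> (iv b \<cdot> b) \<cdot> iv a" using assms by (simp add: assoc del: iv_m)
  also have "\<dots> = z b" using assms by (metis iv_m m_iv m_z)
  finally show "a \<cdot> iv b \<cdot> (b \<cdot> iv a) = z b" .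
  have "b \<cdot> iv a \<cdot> (a \<cdot> iv b) = b \<cdot> (iv a \<cdot> a) \<cdot> iv b" using assms by (simp add: assoc del: iv_m)
  also have "\<dots> = z b" using assms by (metis iv_m m_iv m_z)
  finally show "z b = b \<cdot> iv a \<cdot> (a \<cdot> iv b)" by simp
  show "a \<cdot> iv b \<cdot> z b = a \<cdot> iv b" using assms by (simp add: assoc)
qed (use assms in auto)

lemma z_iv_m:
  assumes "a \<in> S" "b \<in> S" "z a = z b"
  shows "z (iv b \<cdot> a) = z b"
proof (rule z_unique[where y = "iv a \<cdot> b"])
  have "a \<cdot> z b = a" using assms by (metis m_z)
  then show "iv b \<cdot> a \<cdot> z b = iv b \<cdot> a" using assms by (simp add: assoc)
  have "iv b \<cdot> a \<cdot> (iv a \<cdot> b) = iv b \<cdot> (a \<cdot> iv a) \<cdot> b" using assms by (simp add: assoc del: m_iv)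
  also have "\<dots> = z b" using assms by simp
  finally show "iv b \<cdot> a \<cdot> (iv a \<cdot> b) = z b" .
  have "iv a \<cdot> b \<cdot> (iv b \<cdot> a) = iv a \<cdot> (b \<cdot> iv b) \<cdot> a" using assms by (simp add: assoc del: m_iv)
  also have "\<dots> = z b" using assms by (metis iv_m iv_z m_iv)
  finally show "z b = iv a \<cdot> b \<cdot> (iv b \<cdot> a)" by simp
  show "z b \<cdot> (iv b \<cdot> a) = iv b \<cdot> a" using assms by (simp flip: assoc)
qed (use assms in auto)

section \<open>Green's relations in terms of divisibility and of \<open>z\<close>\<close>

text \<open>From \<open>x = z x \<cdot> x\<close> the element \<open>x\<close> already lies in
  \<open>S x\<close>, so equality of the ideals becomes mutual left divisibility.\<close>

lemma green_L_iff:
  "(a, b) \<in> green_L S m \<longleftrightarrow> a \<in> S \<and> b \<in> S \<and> (\<exists>u\<in>S. a = u \<cdot> b) \<and> (\<exists>v\<in>S. b = v \<cdot> a)"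
  (is "_ \<longleftrightarrow> ?R")
proof -
  have *: "insert x ((\<lambda>u. u \<cdot> x) ` S) = (\<lambda>u. u \<cdot> x) ` S" if "x \<in> S" for x
    using that z_m[OF that, symmetric] z_closed[OF that] by blast
  have sub: "(\<lambda>w. w \<cdot> x) ` S \<subseteq> (\<lambda>w. w \<cdot> y) ` S" if "y \<in> S" "u \<in> S" "x = u \<cdot> y" for x y u
    using that by (auto simp flip: assoc)
  show ?thesis
  proof
    assume ab: "(a, b) \<in> green_L S m"
    then have S: "a \<in> S" "b \<in> S"
      by (auto simp: green_L_def)
    have eq: "(\<lambda>u. u \<cdot> a) ` S = (\<lambda>u. u \<cdot> b) ` S"
      using ab *[OF S(1)] *[OF S(2)] by (simp add: green_L_def)
    have "a \<in> (\<lambda>u. u \<cdot> a) ` S" "b \<in> (\<lambda>u. u \<cdot> b) ` S"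
      using * S by blast+
    then show ?R using eq S by auto
  next
    assume ?R
    then obtain u v where S: "a \<in> S" "b \<in> S" and uv: "u \<in> S" "a = u \<cdot> b" "v \<in> S" "b = v \<cdot> a"
      by blast
    have "(\<lambda>u. u \<cdot> a) ` S = (\<lambda>u. u \<cdot> b) ` S"
      using sub[OF S(2) uv(1,2)] sub[OF S(1) uv(3,4)] by (rule equalityI)
    then show "(a, b) \<in> green_L S m"
      using S *[OF S(1)] *[OF S(2)] by (simp add: green_L_def)
  qed
qed

lemma green_R_iff:
  "(a, b) \<in> green_R S m \<longleftrightarrow> a \<in> S \<and> b \<in> S \<and> (\<exists>u\<in>S. a = b \<cdot> u) \<and> (\<exists>v\<in>S. b = a \<cdot> v)"
  (is "_ \<longleftrightarrow> ?R")
proof -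
  have *: "insert x ((\<lambda>u. x \<cdot> u) ` S) = (\<lambda>u. x \<cdot> u) ` S" if "x \<in> S" for x
    using that m_z[OF that, symmetric] z_closed[OF that] by blast
  have sub: "(\<lambda>w. x \<cdot> w) ` S \<subseteq> (\<lambda>w. y \<cdot> w) ` S" if "y \<in> S" "u \<in> S" "x = y \<cdot> u" for x y u
    using that by (auto simp: assoc)
  show ?thesis
  proof
    assume ab: "(a, b) \<in> green_R S m"
    then have S: "a \<in> S" "b \<in> S"
      by (auto simp: green_R_def)
    have eq: "(\<lambda>u. a \<cdot> u) ` S = (\<lambda>u. b \<cdot> u) ` S"
      using ab *[OF S(1)] *[OF S(2)] by (simp add: green_R_def)
    have "a \<in> (\<lambda>u. a \<cdot> u) ` S" "b \<in> (\<lambda>u. b \<cdot> u) ` S"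
      using * S by blast+
    then show ?R using eq S by auto
  next
    assume ?R
    then obtain u v where S: "a \<in> S" "b \<in> S" and uv: "u \<in> S" "a = b \<cdot> u" "v \<in> S" "b = a \<cdot> v"
      by blast
    have "(\<lambda>u. a \<cdot> u) ` S = (\<lambda>u. b \<cdot> u) ` S"
      using sub[OF S(2) uv(1,2)] sub[OF S(1) uv(3,4)] by (rule equalityI)
    then show "(a, b) \<in> green_R S m"
      using S *[OF S(1)] *[OF S(2)] by (simp add: green_R_def)
  qed
qed

lemma green_L_sym: "(a, b) \<in> green_L S m \<Longrightarrow> (b, a) \<in> green_L S m"
  and green_R_sym: "(a, b) \<in> green_R S m \<Longrightarrow> (b, a) \<in> green_R S m"
  by (auto simp: green_L_def green_R_def)

lemma green_L_trans: "(a, b) \<in> green_L S m \<Longrightarrow> (b, c) \<in> green_L S m \<Longrightarrow> (a, c) \<in> green_L S m"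
  and green_R_trans: "(a, b) \<in> green_R S m \<Longrightarrow> (b, c) \<in> green_R S m \<Longrightarrow> (a, c) \<in> green_R S m"
  by (auto simp: green_L_def green_R_def)

lemma green_L_right: "(a, b) \<in> green_L S m \<Longrightarrow> x \<in> S \<Longrightarrow> (a \<cdot> x, b \<cdot> x) \<in> green_L S m"
  by (simp add: green_L_iff) (metis assoc)

lemma green_R_left: "(a, b) \<in> green_R S m \<Longrightarrow> x \<in> S \<Longrightarrow> (x \<cdot> a, x \<cdot> b) \<in> green_R S m"
  by (simp add: green_R_iff) (metis assoc)

text \<open>The multipliers are explicit: \<open>a \<cdot> iv b\<close> carries \<open>b\<close> to
  \<open>a\<close> from the left, since \<open>iv b \<cdot> b = z b = z a\<close>, and
  \<open>iv b \<cdot> a\<close> does so from the right.\<close>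

lemma z_eq_green:
  assumes "a \<in> S" "b \<in> S" "z a = z b"
  shows "(a, b) \<in> green_L S m" "(a, b) \<in> green_R S m"
proof -
  have 1: "a = (a \<cdot> iv b) \<cdot> b" "b = (b \<cdot> iv a) \<cdot> a" "a = b \<cdot> (iv b \<cdot> a)" "b = a \<cdot> (iv a \<cdot> b)"
    using assms by (metis assoc iv_closed iv_m m_z, metis assoc iv_closed iv_m m_z,
      metis assoc iv_closed m_iv z_m, metis assoc iv_closed m_iv z_m)
  show "(a, b) \<in> green_L S m" "(a, b) \<in> green_R S m"
    unfolding green_L_iff green_R_iff using 1 assms by (metis closed iv_closed)+
qed

lemma green_H_iff: "(a, b) \<in> green_H S m \<longleftrightarrow> a \<in> S \<and> b \<in> S \<and> z a = z b"
proof
  have L: "z a \<cdot> z b = z a" if "(a, b) \<in> green_L S m" for a b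
  proof -
    obtain u where u: "a \<in> S" "b \<in> S" "u \<in> S" "a = u \<cdot> b"
      using \<open>(a, b) \<in> green_L S m\<close> by (auto simp: green_L_iff)
    have "a \<cdot> z b = a" using u by (simp add: assoc)
    then show ?thesis using u(1,2) by (metis assoc iv_closed iv_m z_closed)
  qed
  have R: "z b \<cdot> z a = z a" if "(a, b) \<in> green_R S m" for a b
  proof -
    obtain u where u: "a \<in> S" "b \<in> S" "u \<in> S" "a = b \<cdot> u"
      using \<open>(a, b) \<in> green_R S m\<close> by (auto simp: green_R_iff)
    have "z b \<cdot> a = a" using u by (simp flip: assoc)
    then show ?thesis using u(1,2) by (metis assoc iv_closed m_iv z_closed)
  qed
  assume "(a, b) \<in> green_H S m"
  then have LR: "(a, b) \<in> green_L S m" "(a, b) \<in> green_R S m"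
    by (auto simp: green_H_def)
  show "a \<in> S \<and> b \<in> S \<and> z a = z b"
    \<comment> \<open>Both idempotents equal \<open>z a \<cdot> z b\<close>: by \<open>L\<close> it
      is \<open>z a\<close>, and by \<open>R\<close> for the swapped pair it is
      \<open>z b\<close>.\<close>
    using L[OF LR(1)] R[OF green_R_sym[OF LR(2)]] LR by (simp add: green_L_iff)
next
  assume "a \<in> S \<and> b \<in> S \<and> z a = z b"
  then show "(a, b) \<in> green_H S m"
    using z_eq_green by (simp add: green_H_def)
qed

lemma equiv_green_H: "equiv S (green_H S m)"
  by (auto intro!: equivI refl_onI symI transI simp: green_H_iff)

lemma semigroup: "semigroup_on S m"
  by (simp add: semigroup_on_def assoc)

section \<open>A single congruence: kernel, idempotents and idempotent separation\<close>

context
  fixes \<sigma> assumes cong: "congruence_on S m \<sigma>"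
begin

lemma cong_m: "(a, b) \<in> \<sigma> \<Longrightarrow> (c, d) \<in> \<sigma> \<Longrightarrow> (a \<cdot> c, b \<cdot> d) \<in> \<sigma>"
  using cong by (auto simp: congruence_on_def)

lemma cong_refl: "a \<in> S \<Longrightarrow> (a, a) \<in> \<sigma>"
  using cong by (auto simp: congruence_on_def equiv_def refl_on_def)

lemma cong_sym: "(a, b) \<in> \<sigma> \<Longrightarrow> (b, a) \<in> \<sigma>"
  using cong by (auto simp: congruence_on_def equiv_def sym_def)

lemma cong_trans: "(a, b) \<in> \<sigma> \<Longrightarrow> (b, c) \<in> \<sigma> \<Longrightarrow> (a, c) \<in> \<sigma>"
  using cong unfolding congruence_on_def equiv_def by (meson transD)

lemma cong_S: "(a, b) \<in> \<sigma> \<Longrightarrow> a \<in> S \<and> b \<in> S"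
  using cong by (auto simp: congruence_on_def equiv_def)

text \<open>Multiplying the pair by \<open>iv a\<close> on the right turns \<open>a\<close> into
  \<open>z a\<close> and \<open>a \<cdot> a\<close> into \<open>a\<close>. Thus a class that is
  idempotent in the quotient contains an idempotent.\<close>

lemma cong_square:
  assumes "a \<in> S" "(a, a \<cdot> a) \<in> \<sigma>" shows "(a, z a) \<in> \<sigma>"
proof -
  have "(a \<cdot> iv a, a \<cdot> a \<cdot> iv a) \<in> \<sigma>"
    using assms cong_m cong_refl iv_closed by blast
  then show ?thesis
    using assms cong_sym by (simp add: assoc)
qed

text \<open>If \<open>a\<close> is related to an idempotent \<open>e = e \<cdot> e\<close>, then it
  is related to \<open>a \<cdot> a\<close>, and \<open>cong_square\<close> makes \<open>z a\<close>
  a canonical witness.\<close>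

lemma ker_iff: "a \<in> ker S m \<sigma> \<longleftrightarrow> a \<in> S \<and> (a, z a) \<in> \<sigma>"
proof
  assume "a \<in> ker S m \<sigma>"
  then obtain e where e: "a \<in> S" "(a, e) \<in> \<sigma>" "e \<cdot> e = e"
    by (auto simp: ker_def idempotents_def)
  have "(a, a \<cdot> a) \<in> \<sigma>"
    using cong_trans[OF e(2) cong_sym] cong_m[OF e(2) e(2)] e by simp
  then show "a \<in> S \<and> (a, z a) \<in> \<sigma>"
    using e cong_square by simp
qed (auto simp: ker_def intro: z_idempotents)

text \<open>Both idempotents are related to \<open>z a \<cdot> z b\<close>:
  \<open>iv a \<cdot> b\<close> absorbs \<open>z b\<close> on its right, and
  \<open>a \<cdot> iv b\<close> absorbs \<open>z a\<close> on its left.\<close>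

lemma cong_z:
  assumes ab: "(a, b) \<in> \<sigma>" shows "(z a, z b) \<in> \<sigma>"
proof -
  have S [simp]: "a \<in> S" "b \<in> S" using cong_S[OF ab] by auto
  have 1: "(z a, iv a \<cdot> b) \<in> \<sigma>"
    using cong_m[OF cong_refl ab, of "iv a"] by simp
  have "(z a \<cdot> z b, iv a \<cdot> b) \<in> \<sigma>"
    using cong_m[OF 1 cong_refl, of "z b"] by (simp add: assoc)
  then have "(z a, z a \<cdot> z b) \<in> \<sigma>"
    using 1 cong_sym cong_trans by blast
  moreover have 2: "(a \<cdot> iv b, z b) \<in> \<sigma>"
    using cong_m[OF ab cong_refl, of "iv b"] by simp
  have "(a \<cdot> iv b, z a \<cdot> z b) \<in> \<sigma>"
    using cong_m[OF cong_refl 2, of "z a"] by (simp flip: assoc)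
  then have "(z a \<cdot> z b, z b) \<in> \<sigma>"
    using 2 cong_sym cong_trans by blast
  ultimately show ?thesis
    using cong_trans by blast
qed

text \<open>By \<open>cong_z\<close>, related elements have related idempotents \<open>z a\<close>
  and \<open>z b\<close>, and \<open>green_H\<close> is equality of these.\<close>

lemma idempotent_separating_iff:
  "idempotent_separating S m \<sigma> \<longleftrightarrow> \<sigma> \<subseteq> green_H S m"
proof
  assume i: "idempotent_separating S m \<sigma>"
  show "\<sigma> \<subseteq> green_H S m"
  proof (rule subrelI)
    fix a b assume ab: "(a, b) \<in> \<sigma>"
    then show "(a, b) \<in> green_H S m"
      using i cong_z[OF ab] cong_S[OF ab] z_idempotents
      by (auto simp: green_H_iff idempotent_separating_def)
  qed
next
  assume "\<sigma> \<subseteq> green_H S m"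
  then show "idempotent_separating S m \<sigma>"
    unfolding idempotent_separating_def using green_H_iff z_idem by (metis subsetD)
qed

text \<open>The class of an idempotent is a subsemigroup, and a group has only one idempotent.
  Conversely, a class closed under products contains \<open>z x\<close> for each of its elements
  \<open>x\<close>, all these idempotents coincide, and the common value is the identity.\<close>

lemma over_groups_iff: "over_groups S m \<sigma> \<longleftrightarrow> idempotent_separating S m \<sigma>"
proof
  assume og: "over_groups S m \<sigma>"
  show "idempotent_separating S m \<sigma>"
    unfolding idempotent_separating_def
  proof (intro ballI impI)
    fix e f assume ef: "e \<in> idempotents S m" "f \<in> idempotents S m" "(e, f) \<in> \<sigma>"
    let ?C = "\<sigma> `` {e}"
    have e: "e \<in> S" "e \<cdot> e = e" and f: "f \<cdot> f = f"
      using ef by (auto simp: idempotents_def)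
    have "subsemigroup_of ?C S m"
      using e cong_m[of e _ e] cong_refl[of e] cong_S by (fastforce simp: subsemigroup_of_def)
    moreover have "?C \<in> S // \<sigma>" using e by (auto intro: quotientI)
    ultimately obtain u where "group \<lparr>carrier = ?C, monoid.mult = m, one = u\<rparr>"
      using og by (auto simp: over_groups_def is_group_on_def)
    then interpret G: group "\<lparr>carrier = ?C, monoid.mult = m, one = u\<rparr>" .
    have "e = u" "f = u"
      using G.l_cancel_one[of e e] G.l_cancel_one[of f f] cong_refl e f ef(3) by auto
    then show "e = f" by simp
  qed
next
  assume i: "idempotent_separating S m \<sigma>"
  show "over_groups S m \<sigma>"
    unfolding over_groups_def
  proof (intro ballI impI)
    fix C assume C: "C \<in> S // \<sigma>" and sub: "subsemigroup_of C S m"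
    have CS: "C \<subseteq> S" and Cm: "\<And>x y. x \<in> C \<Longrightarrow> y \<in> C \<Longrightarrow> x \<cdot> y \<in> C"
      using sub by (auto simp: subsemigroup_of_def)
    have eq: "equiv S \<sigma>" using cong by (simp add: congruence_on_def)
    have rel: "(x, y) \<in> \<sigma>" if "x \<in> C" "y \<in> C" for x y
      using that C quotient_eq_iff[OF eq C C] by blast
    have mem: "y \<in> C" if "x \<in> C" "(x, y) \<in> \<sigma>" for x y
      using that C eq by (meson in_quotient_imp_closed)
    obtain a where a: "a \<in> C" using sub by (auto simp: subsemigroup_of_def)
    have xz: "(x, z x) \<in> \<sigma>" if "x \<in> C" for x
      using that rel Cm CS cong_square by blast
    have zz: "z x = z a" if "x \<in> C" for x
      using idempotent_separating_iff i rel[OF that a] by (auto simp: green_H_iff)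
    \<comment> \<open>Here \<open>x\<close> is related to \<open>z x = x \<cdot> iv x\<close>, and
      replacing the first factor by \<open>z x\<close> yields
      \<open>z x \<cdot> iv x = iv x\<close>.\<close>
    have ivC: "iv x \<in> C" if "x \<in> C" for x
    proof (rule mem)
      have x: "x \<in> S" using that CS by auto
      show "(x, iv x) \<in> \<sigma>"
        using cong_trans[OF xz[OF that]] cong_m[OF xz[OF that] cong_refl[of "iv x"]] x by simp
    qed (rule that)
    have "group \<lparr>carrier = C, monoid.mult = m, one = z a\<rparr>"
    proof (rule groupI, goal_cases)
      case 2 show ?case using mem[OF a] xz[OF a] by simp
    next
      case (4 x) then show ?case using zz[of x] CS by auto (metis subsetD z_m)
    next
      case (5 x) then show ?case using ivC[of x] zz[of x] CS iv_m[of x] by (intro bexI[of _ "iv x"]) auto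
    qed (use Cm CS in \<open>auto intro!: assoc\<close>)
    then show "is_group_on C m" by (auto simp: is_group_on_def)
  qed
qed

end

section \<open>Extremal congruences, and the relation \<open>Theta\<close>\<close>

lemma equiv_cong: "congruence_on S m \<sigma> \<Longrightarrow> equiv S \<sigma>"
  by (simp add: congruence_on_def)

text \<open>The witness \<open>z a\<close> from \<open>ker_iff\<close> is the same for every
  congruence, so kernels commute with intersections.\<close>

lemma ker_Int:
  assumes "congruence_on S m \<sigma>" "congruence_on S m \<tau>"
  shows "ker S m (\<sigma> \<inter> \<tau>) = ker S m \<sigma> \<inter> ker S m \<tau>"
  using ker_iff[OF assms(1)] ker_iff[OF assms(2)] ker_iff[OF congruence_on_Int[OF assms]] by auto

lemma greatest_idem_sep_properties:
  shows "congruence_on S m (greatest_idem_sep S m)" (is ?A)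
    and "greatest_idem_sep S m \<subseteq> green_H S m" (is ?B)
    and "congruence_on S m \<sigma> \<Longrightarrow> \<sigma> \<subseteq> green_H S m \<Longrightarrow> \<sigma> \<subseteq> greatest_idem_sep S m"
proof -
  \<comment> \<open>The largest congruence inside \<open>green_H S m\<close>: pairs that stay
    \<H>-related in every context. The conjunct \<open>z a = z b\<close> is the context without
    multipliers.\<close>
  define \<mu> where "\<mu> = {(a, b) \<in> S \<times> S. z a = z b \<and>
    (\<forall>x\<in>S. \<forall>y\<in>S. z (x \<cdot> a \<cdot> y) = z (x \<cdot> b \<cdot> y))}"
  have eq: "equiv S \<mu>"
    unfolding \<mu>_def by (auto intro!: equivI refl_onI symI transI)
  have cong: "congruence_on S m \<mu>"
  proof (rule congruence_onI[OF eq closed])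
    fix c a b assume c: "c \<in> S" and "(a, b) \<in> \<mu>"
    then have S: "a \<in> S" "b \<in> S" and zz: "z a = z b"
      and xy: "\<And>x y. x \<in> S \<Longrightarrow> y \<in> S \<Longrightarrow> z (x \<cdot> a \<cdot> y) = z (x \<cdot> b \<cdot> y)"
      by (auto simp: \<mu>_def)
    \<comment> \<open>The one-sided context comes from the two-sided one with
      \<open>y = z a\<close>, a right identity for both \<open>a\<close> and \<open>b\<close>
      because \<open>z a = z b\<close>.\<close>
    have "z (c \<cdot> a) = z (c \<cdot> b)"
      using xy[of c "z a"] S c m_z[of a] m_z[of b, folded zz] by (simp add: assoc)
    then show "(c \<cdot> a, c \<cdot> b) \<in> \<mu>"
      using S c xy by (simp add: \<mu>_def flip: assoc)
    have "z (a \<cdot> c) = z (b \<cdot> c)"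
      using xy[of "z a" c] S c z_m[of a] z_m[of b, folded zz] by simp
    then show "(a \<cdot> c, b \<cdot> c) \<in> \<mu>"
      using S c xy[of _ "c \<cdot> _"] by (simp add: \<mu>_def assoc)
  qed
  have H: "\<mu> \<subseteq> green_H S m"
    by (auto simp: \<mu>_def green_H_iff)
  have gr: "\<sigma> \<subseteq> \<mu>" if \<sigma>: "congruence_on S m \<sigma>" "\<sigma> \<subseteq> green_H S m" for \<sigma>
  proof (rule subrelI)
    fix a b assume ab: "(a, b) \<in> \<sigma>"
    have "(x \<cdot> a \<cdot> y, x \<cdot> b \<cdot> y) \<in> green_H S m" if "x \<in> S" "y \<in> S" for x y
      using that \<sigma> ab by (meson cong_m cong_refl subsetD)
    then show "(a, b) \<in> \<mu>"
      using ab \<sigma> green_H_iff by (auto simp: \<mu>_def)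
  qed
  have g: "greatest_idem_sep S m = \<mu>"
    unfolding greatest_idem_sep_def
    by (rule Greatest_equality) (use cong H gr idempotent_separating_iff in auto)
  show ?A ?B using g cong H by auto
  show "\<sigma> \<subseteq> greatest_idem_sep S m" if "congruence_on S m \<sigma>" "\<sigma> \<subseteq> green_H S m"
    using g gr that by auto
qed

text \<open>The least congruence is the intersection of all candidates. It keeps the kernel, since
  membership of \<open>a\<close> only asks for the pair \<open>(a, z a)\<close>.\<close>

lemma least_same_ker_properties:
  assumes "congruence_on S m \<rho>"
  shows "congruence_on S m (least_same_ker S m \<rho>)" (is ?A)
    and "ker S m (least_same_ker S m \<rho>) = ker S m \<rho>" (is ?B)
    and "congruence_on S m \<sigma> \<Longrightarrow> ker S m \<sigma> = ker S m \<rho> \<Longrightarrow> least_same_ker S m \<rho> \<subseteq> \<sigma>"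
proof -
  let ?C = "{\<sigma>. congruence_on S m \<sigma> \<and> ker S m \<sigma> = ker S m \<rho>}"
  have cong: "congruence_on S m (\<Inter>?C)"
    using assms by (intro congruence_on_Inter) auto
  have "a \<in> ker S m (\<Inter>?C) \<longleftrightarrow> a \<in> ker S m \<rho>" for a
    unfolding ker_iff[OF cong] using ker_iff assms by blast
  then have k: "ker S m (\<Inter>?C) = ker S m \<rho>" by blast
  have l: "least_same_ker S m \<rho> = \<Inter>?C"
    unfolding least_same_ker_def by (rule Least_equality) (use cong k in auto)
  show ?A ?B using l cong k by auto
  show "least_same_ker S m \<rho> \<subseteq> \<sigma>" if "congruence_on S m \<sigma>" "ker S m \<sigma> = ker S m \<rho>"
    using l that by auto
qed

text \<open>Idempotent separation says that \<sigma> has the trace of equality, and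
  \<open>Id_on S\<close> lies below every congruence on \<open>S\<close>.\<close>

lemma least_same_tr_eq_Id_on_iff:
  assumes "congruence_on S m \<sigma>"
  shows "least_same_tr S m \<sigma> = Id_on S \<longleftrightarrow> idempotent_separating S m \<sigma>"
proof -
  let ?C = "{\<tau>. congruence_on S m \<tau> \<and> tr S m \<tau> = tr S m \<sigma>}"
  have cong: "congruence_on S m (\<Inter>?C)"
    using assms by (intro congruence_on_Inter) auto
  have k: "tr S m (\<Inter>?C) = tr S m \<sigma>"
    using assms by (auto simp: tr_def)
  have l: "least_same_tr S m \<sigma> = \<Inter>?C"
    unfolding least_same_tr_def by (rule Least_equality) (use cong k in auto)
  have sep: "tr S m \<sigma> = tr S m (Id_on S) \<longleftrightarrow> idempotent_separating S m \<sigma>"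
  proof
    assume eq: "tr S m \<sigma> = tr S m (Id_on S)"
    show "idempotent_separating S m \<sigma>"
      unfolding idempotent_separating_def
    proof (intro ballI impI)
      fix e f assume "e \<in> idempotents S m" "f \<in> idempotents S m" "(e, f) \<in> \<sigma>"
      then have "(e, f) \<in> tr S m \<sigma>" by (simp add: tr_def)
      then show "e = f" unfolding eq by (simp add: tr_def Id_on_iff)
    qed
  next
    assume "idempotent_separating S m \<sigma>"
    then have "(e, f) \<in> tr S m \<sigma> \<longleftrightarrow> (e, f) \<in> tr S m (Id_on S)" for e f
      unfolding tr_def idempotent_separating_def Int_iff mem_Times_iff fst_conv snd_conv Id_on_iff
      using cong_refl[OF assms, of e] cong_S[OF assms, of e f] by blast
    then show "tr S m \<sigma> = tr S m (Id_on S)" by (simp add: set_eq_iff)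
  qed
  show ?thesis
  proof
    assume "least_same_tr S m \<sigma> = Id_on S"
    then show "idempotent_separating S m \<sigma>" using l k sep by auto
  next
    assume "idempotent_separating S m \<sigma>"
    then have "Id_on S \<in> ?C"
      using sep congruence_on_Id_on[OF semigroup] by simp
    moreover have "Id_on S \<subseteq> \<tau>" if "\<tau> \<in> ?C" for \<tau>
      using that cong_refl by auto
    ultimately show "least_same_tr S m \<sigma> = Id_on S" unfolding l by blast
  qed
qed

text \<open>\<open>Theta\<close> relates any two idempotents, both sides being their product, but is
  equality inside an \<H>-class, where \<open>z a \<cdot> b = b\<close> and
  \<open>a \<cdot> z b = a\<close>. The equation for \<open>iv\<close> identifies \<open>z\<close>
  with \<open>cr_zero S m\<close>.\<close>

lemma Int_Theta_eq_Id_on_iff: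
  assumes "congruence_on S m \<sigma>" and "iv = cr_inverse S m"
  shows "\<sigma> \<inter> Theta S m = Id_on S \<longleftrightarrow> idempotent_separating S m \<sigma>"
proof -
  have T: "Theta S m = {(a, b) \<in> S \<times> S. z a \<cdot> b = a \<cdot> z b}"
    by (simp add: Theta_def cr_zero_def flip: assms(2))
  show ?thesis
  proof
    assume Id: "\<sigma> \<inter> Theta S m = Id_on S"
    have "(e, f) \<in> Theta S m" if "e \<in> idempotents S m" "f \<in> idempotents S m" for e f
      using that z_idem by (simp add: T idempotents_def)
    moreover have "e = f" if "(e, f) \<in> \<sigma>" "(e, f) \<in> Theta S m" for e f
    proof -
      have "(e, f) \<in> Id_on S" using that unfolding Id[symmetric] by (rule IntI)
      then show ?thesis by (rule Id_onE) simp
    qed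
    ultimately show "idempotent_separating S m \<sigma>"
      unfolding idempotent_separating_def by meson
  next
    assume "idempotent_separating S m \<sigma>"
    then have zz: "z a = z b" if "(a, b) \<in> \<sigma>" for a b
      using that idempotent_separating_iff[OF assms(1)] green_H_iff by blast
    have "a = b" if "(a, b) \<in> \<sigma>" "(a, b) \<in> Theta S m" for a b
    proof -
      have S: "a \<in> S" "b \<in> S" "z a \<cdot> b = a \<cdot> z b" using that(2) by (auto simp: T)
      have "b = z a \<cdot> b" unfolding zz[OF that(1)] using S(2) by simp
      also have "\<dots> = a \<cdot> z a" unfolding S(3) unfolding zz[OF that(1)] ..
      also have "\<dots> = a" using S(1) by simp
      finally show ?thesis ..
    qed
    then have "\<sigma> \<inter> Theta S m \<subseteq> Id_on S"
      using cong_S[OF assms(1)] by (intro subrelI) (auto simp: Id_on_iff)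
    moreover have "Id_on S \<subseteq> \<sigma> \<inter> Theta S m"
      using cong_refl[OF assms(1)] by (auto simp: T)
    ultimately show "\<sigma> \<inter> Theta S m = Id_on S" ..
  qed
qed

section \<open>Conditions equivalent for every congruence \<rho>\<close>

text \<open>As a congruence inside \<open>green_H S m\<close>, the intersection
  \<open>\<rho> \<inter> green_H S m\<close> falls below the greatest one.\<close>

lemma Int_greatest_idem_sep_cong_iff:
  assumes "congruence_on S m \<rho>"
  shows "\<rho> \<inter> green_H S m = \<rho> \<inter> greatest_idem_sep S m \<longleftrightarrow> congruence_on S m (\<rho> \<inter> green_H S m)"
proof
  assume "\<rho> \<inter> green_H S m = \<rho> \<inter> greatest_idem_sep S m"
  then show "congruence_on S m (\<rho> \<inter> green_H S m)"
    using congruence_on_Int[OF assms greatest_idem_sep_properties(1)] by simp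
next
  assume "congruence_on S m (\<rho> \<inter> green_H S m)"
  then show "\<rho> \<inter> green_H S m = \<rho> \<inter> greatest_idem_sep S m"
    using greatest_idem_sep_properties(2,3) by blast
qed

lemma ker_subset_greatest_idem_sep_iff:
  assumes \<rho>: "congruence_on S m \<rho>"
  shows "ker S m \<rho> \<subseteq> ker S m (greatest_idem_sep S m) \<longleftrightarrow>
    \<rho> \<inter> green_H S m = \<rho> \<inter> greatest_idem_sep S m"
proof
  let ?\<mu> = "greatest_idem_sep S m"
  note \<mu> = greatest_idem_sep_properties(1)
  assume eq: "\<rho> \<inter> green_H S m = \<rho> \<inter> ?\<mu>"
  show "ker S m \<rho> \<subseteq> ker S m ?\<mu>"
  proof
    fix a assume "a \<in> ker S m \<rho>"
    then have "a \<in> S" "(a, z a) \<in> \<rho>" using ker_iff[OF \<rho>] by auto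
    \<comment> \<open>Every element is \<H>-related to its own idempotent, so a kernel element
      contributes the pair \<open>(a, z a)\<close> to
      \<open>\<rho> \<inter> green_H S m\<close>.\<close>
    moreover then have "(a, z a) \<in> green_H S m"
      using z_idem[OF z_idempotents] by (simp add: green_H_iff)
    ultimately show "a \<in> ker S m ?\<mu>" using eq ker_iff[OF \<mu>] by blast
  qed
next
  let ?\<mu> = "greatest_idem_sep S m"
  note \<mu> = greatest_idem_sep_properties(1)
  assume sub: "ker S m \<rho> \<subseteq> ker S m ?\<mu>"
  have "(a, b) \<in> ?\<mu>" if "(a, b) \<in> \<rho>" "(a, b) \<in> green_H S m" for a b
  proof -
    have S: "a \<in> S" "b \<in> S" "z a = z b" using that green_H_iff by auto
    have "(a \<cdot> iv b, z (a \<cdot> iv b)) \<in> \<rho>"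
      using cong_m[OF \<rho> that(1) cong_refl[OF \<rho>, of "iv b"]] S z_m_iv by simp
    then have "a \<cdot> iv b \<in> ker S m ?\<mu>"
      using sub S by (auto simp: ker_iff[OF \<rho>])
    then have "(a \<cdot> iv b, z b) \<in> ?\<mu>"
      using ker_iff[OF \<mu>] S z_m_iv by simp
    \<comment> \<open>Multiplying back by \<open>b\<close> recovers the pair \<open>(a, b)\<close>,
      since \<open>a \<cdot> z b = a \<cdot> z a = a\<close>.\<close>
    then have "(a \<cdot> iv b \<cdot> b, z b \<cdot> b) \<in> ?\<mu>"
      using cong_m[OF \<mu> _ cong_refl[OF \<mu>]] S by blast
    then show ?thesis using S m_z[of a] by (simp add: assoc)
  qed
  then show "\<rho> \<inter> green_H S m = \<rho> \<inter> ?\<mu>"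
    using greatest_idem_sep_properties(2) by auto
qed

text \<open>Under the kernel inclusion, \<rho> intersected with the greatest idempotent separating
  congruence still has the kernel of \<rho>, so the least such congruence lies below it. The
  converse is monotonicity of kernels.\<close>

lemma least_same_ker_subset_iff:
  assumes \<rho>: "congruence_on S m \<rho>"
  shows "least_same_ker S m \<rho> \<subseteq> greatest_idem_sep S m \<longleftrightarrow>
    ker S m \<rho> \<subseteq> ker S m (greatest_idem_sep S m)"
proof
  let ?\<mu> = "greatest_idem_sep S m"
  note \<mu> = greatest_idem_sep_properties(1)
  note k = least_same_ker_properties[OF \<rho>]
  assume "least_same_ker S m \<rho> \<subseteq> ?\<mu>"
  then show "ker S m \<rho> \<subseteq> ker S m ?\<mu>" unfolding k(2)[symmetric] by (auto simp: ker_def)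
next
  let ?\<mu> = "greatest_idem_sep S m"
  note \<mu> = greatest_idem_sep_properties(1)
  assume "ker S m \<rho> \<subseteq> ker S m ?\<mu>"
  then have "ker S m (\<rho> \<inter> ?\<mu>) = ker S m \<rho>"
    using ker_Int[OF \<rho> \<mu>] by auto
  then show "least_same_ker S m \<rho> \<subseteq> ?\<mu>"
    using least_same_ker_properties(3)[OF \<rho> congruence_on_Int[OF \<rho> \<mu>]] by blast
qed

section \<open>The kernel of an orthodox congruence and its Green relation\<close>

text \<open>Kernel elements are exactly those whose class is idempotent in the quotient, so
  orthodoxy closes them under products. A kernel element satisfies \<open>a \<rho> z a\<close>,
  hence \<open>z a \<rho> iv a\<close>, which closes them under \<open>iv\<close>.\<close>

lemma ker_cr_semigroup:
  assumes "orthodox_congruence S m \<rho>"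
  shows "cr_semigroup (ker S m \<rho>) m iv"
proof -
  have \<rho>: "congruence_on S m \<rho>" and orth: "orthodox (S // \<rho>) (quotient_mult m \<rho>)"
    using assms by (auto simp: orthodox_congruence_def)
  have idem: "\<rho> `` {a} \<in> idempotents (S // \<rho>) (quotient_mult m \<rho>) \<longleftrightarrow> a \<in> ker S m \<rho>"
    if "a \<in> S" for a
  proof -
    have "\<rho> `` {a} \<in> idempotents (S // \<rho>) (quotient_mult m \<rho>) \<longleftrightarrow> (a \<cdot> a, a) \<in> \<rho>"
      using that quotient_mult_classes[OF \<rho> that that] eq_equiv_class_iff[OF equiv_cong[OF \<rho>]]
      by (simp add: idempotents_def quotientI)
    also have "\<dots> \<longleftrightarrow> a \<in> ker S m \<rho>"
    proof
      assume "(a \<cdot> a, a) \<in> \<rho>"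
      then show "a \<in> ker S m \<rho>"
        using that cong_square[OF \<rho>] cong_sym[OF \<rho>] ker_iff[OF \<rho>] by blast
    next
      assume "a \<in> ker S m \<rho>"
      then have "(a, z a) \<in> \<rho>" using ker_iff[OF \<rho>] by blast
      then show "(a \<cdot> a, a) \<in> \<rho>"
        using cong_m[OF \<rho> _ cong_refl[OF \<rho>], of a "z a" a] that by simp
    qed
    finally show ?thesis .
  qed
  have "a \<cdot> b \<in> ker S m \<rho>" if "a \<in> ker S m \<rho>" "b \<in> ker S m \<rho>" for a b
  proof -
    have S: "a \<in> S" "b \<in> S" using that by (auto simp: ker_def)
    show ?thesis
      using orth idem[OF S(1)] idem[OF S(2)] idem[OF closed[OF S]] that
        quotient_mult_classes[OF \<rho> S] by (simp add: orthodox_def) metis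
  qed
  moreover have "iv a \<in> ker S m \<rho>" if "a \<in> ker S m \<rho>" for a
  proof -
    have a: "a \<in> S" "(a, z a) \<in> \<rho>" using that ker_iff[OF \<rho>] by auto
    have "(z a, iv a) \<in> \<rho>"
      using cong_m[OF \<rho> a(2) cong_refl[OF \<rho>], of "iv a"] a by simp
    then show ?thesis
      using a cong_sym[OF \<rho>] by (simp add: ker_iff[OF \<rho>] z_iv_eq)
  qed
  moreover have "ker S m \<rho> \<subseteq> S" by (auto simp: ker_def)
  ultimately show ?thesis
    by unfold_locales (auto simp: subset_iff assoc m_iv_m iv_m_iv iv_comm)
qed

text \<open>Kernel and \<open>S\<close> share \<open>iv\<close>, hence \<open>z\<close>, and in both
  semigroups \<H> is equality of \<open>z\<close>.\<close>

lemma green_H_ker: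
  assumes "orthodox_congruence S m \<rho>"
  shows "green_H (ker S m \<rho>) m = green_H S m \<inter> (ker S m \<rho> \<times> ker S m \<rho>)"
proof -
  interpret K: cr_semigroup "ker S m \<rho>" m iv by (rule ker_cr_semigroup[OF assms])
  have "K.z = z" by (simp add: fun_eq_iff K.z_def z_def)
  then have "x \<in> green_H (ker S m \<rho>) m \<longleftrightarrow>
      x \<in> green_H S m \<inter> (ker S m \<rho> \<times> ker S m \<rho>)" for x
    using K.green_H_iff green_H_iff by (cases x) (auto simp: ker_def)
  then show ?thesis by blast
qed

lemma cryptic_ker_iff:
  assumes o: "orthodox_congruence S m \<rho>"
  shows "cryptic (ker S m \<rho>) m \<longleftrightarrow> congruence_on S m (\<rho> \<inter> green_H S m)"
proof
  interpret K: cr_semigroup "ker S m \<rho>" m iv by (rule ker_cr_semigroup[OF o])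
  have \<rho>: "congruence_on S m \<rho>" using o by (simp add: orthodox_congruence_def)
  assume cong: "congruence_on S m (\<rho> \<inter> green_H S m)"
  \<comment> \<open>Both elements are \<rho>-related to the same idempotent
    \<open>z a = z b\<close>, so \<H> of the kernel is the restriction of
    \<open>\<rho> \<inter> green_H S m\<close>.\<close>
  have H: "(a, b) \<in> \<rho>" if "(a, b) \<in> green_H (ker S m \<rho>) m" for a b
  proof -
    have "(a, z a) \<in> \<rho>" "(b, z b) \<in> \<rho>" "z a = z b"
      using that green_H_ker[OF o] by (auto simp: ker_iff[OF \<rho>] green_H_iff)
    then show ?thesis using cong_sym[OF \<rho>] cong_trans[OF \<rho>] by metis
  qed
  have "(a \<cdot> c, b \<cdot> d) \<in> green_H (ker S m \<rho>) m"
    if "(a, b) \<in> green_H (ker S m \<rho>) m" "(c, d) \<in> green_H (ker S m \<rho>) m" for a b c d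
    using cong_m[OF cong, of a b c d] H[OF that(1)] H[OF that(2)] that green_H_ker[OF o]
    by auto
  then show "cryptic (ker S m \<rho>) m"
    using K.equiv_green_H by (auto simp: cryptic_def congruence_on_def)
next
  interpret K: cr_semigroup "ker S m \<rho>" m iv by (rule ker_cr_semigroup[OF o])
  have \<rho>: "congruence_on S m \<rho>" using o by (simp add: orthodox_congruence_def)
  assume cr: "cryptic (ker S m \<rho>) m"
  have Hm: "(a \<cdot> c, b \<cdot> d) \<in> green_H S m"
    if "(a, b) \<in> green_H S m" "(c, d) \<in> green_H S m"
      "a \<in> ker S m \<rho>" "b \<in> ker S m \<rho>" "c \<in> ker S m \<rho>" "d \<in> ker S m \<rho>" for a b c d
    using that cr green_H_ker[OF o] by (auto simp: cryptic_def congruence_on_def)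
  \<comment> \<open>An arbitrary multiplier \<open>x\<close> may lie outside the kernel, but
    \<open>z x\<close> lies in it and can be used with \<open>Hm\<close> in its place.\<close>
  have zK: "z x \<in> ker S m \<rho>" if "x \<in> S" for x
    using that z_idem[OF z_idempotents] cong_refl[OF \<rho>] by (simp add: ker_iff[OF \<rho>])
  have zx: "z (z x) = z x" if "x \<in> S" for x
    using that z_idem[OF z_idempotents] by simp
  have "equiv S (\<rho> \<inter> green_H S m)"
    using equiv_cong[OF \<rho>] equiv_green_H
    by (auto simp: equiv_def refl_on_def sym_Int trans_Int)
  then show "congruence_on S m (\<rho> \<inter> green_H S m)"
  proof (rule congruence_onI[OF _ closed])
    fix x a b assume x: "x \<in> S" and "(a, b) \<in> \<rho> \<inter> green_H S m"
    then have ab: "(a, b) \<in> \<rho>" and S: "a \<in> S" "b \<in> S" and zz: "z a = z b"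
      by (auto simp: green_H_iff)
    have LR: "(a, b) \<in> green_L S m" "(a, b) \<in> green_R S m"
      using z_eq_green S zz by auto
    \<comment> \<open>Kernel elements measuring the difference of \<open>a\<close> and
      \<open>b\<close>: \<open>?c \<cdot> b = a\<close> and \<open>b \<cdot> ?d = a\<close>, both
      with idempotent \<open>z b\<close>.\<close>
    let ?c = "a \<cdot> iv b" and ?d = "iv b \<cdot> a"
    show "(x \<cdot> a, x \<cdot> b) \<in> \<rho> \<inter> green_H S m"
    proof -
      have c: "?c \<in> ker S m \<rho>" "z ?c = z b" "?c \<cdot> b = a"
        using cong_m[OF \<rho> ab cong_refl[OF \<rho>, of "iv b"]] S z_m_iv zz m_z[of a]
        by (auto simp: ker_iff[OF \<rho>] assoc)
      have "(z x \<cdot> ?c, z x \<cdot> z b) \<in> green_H S m"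
        by (rule Hm) (use c x S zK zx in \<open>auto simp: green_H_iff\<close>)
      then have "(z x \<cdot> ?c, z x \<cdot> z b) \<in> green_L S m" by (simp add: green_H_def)
      \<comment> \<open>Right translation of this pair by \<open>?c\<close> and by
        \<open>z b\<close> exchanges the left factor \<open>z x\<close> for \<open>x\<close> in both
        products.\<close>
      moreover have "(x, z x) \<in> green_L S m" using z_eq_green x zx by auto
      ultimately have "(x \<cdot> ?c, x \<cdot> z b) \<in> green_L S m"
        using green_L_right green_L_sym green_L_trans S closed iv_closed z_closed by metis
      then have "(x \<cdot> ?c \<cdot> b, x \<cdot> z b \<cdot> b) \<in> green_L S m"
        using green_L_right S by blast
      then have "(x \<cdot> a, x \<cdot> b) \<in> green_L S m"
        using x S c(3) by (simp add: assoc)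
      then show ?thesis
        using green_R_left[OF LR(2) x] cong_m[OF \<rho> cong_refl[OF \<rho> x] ab]
        by (simp add: green_H_def)
    qed
    \<comment> \<open>The dual argument: \<open>?d\<close> replaces \<open>?c\<close>, and \<L> and
      \<R> exchange roles.\<close>
    show "(a \<cdot> x, b \<cdot> x) \<in> \<rho> \<inter> green_H S m"
    proof -
      have d: "?d \<in> ker S m \<rho>" "z ?d = z b" "b \<cdot> ?d = a"
      proof -
        show zd: "z ?d = z b"
          using S zz by (rule z_iv_m)
        show "?d \<in> ker S m \<rho>"
          using cong_m[OF \<rho> cong_refl[OF \<rho>, of "iv b"] ab] S zd
          by (auto simp: ker_iff[OF \<rho>])
        show "b \<cdot> ?d = a" using S zz z_m[of a] by (simp flip: assoc)
      qed
      have "(?d \<cdot> z x, z b \<cdot> z x) \<in> green_H S m"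
        by (rule Hm) (use d x S zK zx in \<open>auto simp: green_H_iff\<close>)
      then have "(?d \<cdot> z x, z b \<cdot> z x) \<in> green_R S m" by (simp add: green_H_def)
      moreover have "(x, z x) \<in> green_R S m" using z_eq_green x zx by auto
      ultimately have "(?d \<cdot> x, z b \<cdot> x) \<in> green_R S m"
        using green_R_left green_R_sym green_R_trans S closed iv_closed z_closed by metis
      then have "(b \<cdot> (?d \<cdot> x), b \<cdot> (z b \<cdot> x)) \<in> green_R S m"
        using green_R_left S by blast
      then have "(a \<cdot> x, b \<cdot> x) \<in> green_R S m"
        using x S d(3) by (simp flip: assoc)
      then show ?thesis
        using green_L_right[OF LR(1) x] cong_m[OF \<rho> ab cong_refl[OF \<rho> x]]
        by (simp add: green_H_def)
    qed
  qed
qed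

end

section \<open>Inverses in maximal subgroups as the unary operation\<close>

text \<open>The description in \<open>cr_inverse\<close> denotes: a maximal subgroup containing
  \<open>a\<close> exists, and every candidate is a commuting inverse of \<open>a\<close>, which is
  unique.\<close>

lemma cr_inverse_properties:
  assumes cr: "completely_regular S m" and a: "a \<in> S"
  defines "b \<equiv> cr_inverse S m a"
  shows "b \<in> S \<and> m (m a b) a = a \<and> m (m b a) b = b \<and> m b a = m a b"
proof -
  have clos: "\<And>x y. x \<in> S \<Longrightarrow> y \<in> S \<Longrightarrow> m x y \<in> S"
    and assoc: "\<And>x y z. x \<in> S \<Longrightarrow> y \<in> S \<Longrightarrow> z \<in> S \<Longrightarrow> m (m x y) z = m x (m y z)"
    using cr by (auto simp: completely_regular_def semigroup_on_def)
  define P where "P b \<longleftrightarrow> b \<in> S \<and> m (m a b) a = a \<and> m (m b a) b = b \<and> m b a = m a b" for b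
  define Q where "Q b \<longleftrightarrow> (\<exists>G e. maximal_subgroup_of G S m \<and> a \<in> G \<and>
        group \<lparr>carrier = G, monoid.mult = m, one = e\<rparr> \<and>
        b = inv\<^bsub>\<lparr>carrier = G, monoid.mult = m, one = e\<rparr>\<^esub> a)" for b
  \<comment> \<open>Commutation gives \<open>m a b = m c a\<close>, whence
    \<open>b = m (m c a) b = m c (m c a) = c\<close>.\<close>
  have P_unique: "b = c" if "P b" "P c" for b c
  proof -
    have S: "b \<in> S" "c \<in> S" using that by (auto simp: P_def)
    have "m a b = m (m (m a c) a) b" using that by (simp add: P_def)
    also have "\<dots> = m (m a c) (m a b)" using a S clos assoc by simp
    also have "\<dots> = m (m c a) (m b a)" using that by (simp add: P_def)
    also have "\<dots> = m c (m (m a b) a)" using a S clos assoc by simp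
    also have "\<dots> = m c a" using that by (simp add: P_def)
    finally have ab: "m a b = m c a" .
    have "b = m (m c a) b" using ab that by (metis P_def)
    also have "\<dots> = m c (m c a)" using ab a S assoc by simp
    also have "\<dots> = c" using that a S assoc by (metis P_def)
    finally show ?thesis .
  qed
  have QP: "P b" if "Q b" for b
  proof -
    obtain G e where G: "maximal_subgroup_of G S m" "a \<in> G"
      "group \<lparr>carrier = G, monoid.mult = m, one = e\<rparr>"
      "b = inv\<^bsub>\<lparr>carrier = G, monoid.mult = m, one = e\<rparr>\<^esub> a"
      using \<open>Q b\<close> unfolding Q_def by blast
    interpret G: group "\<lparr>carrier = G, monoid.mult = m, one = e\<rparr>" by fact
    have "G \<subseteq> S" using G(1) by (simp add: maximal_subgroup_of_def subgroup_of_def)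
    moreover have "b \<in> G" using G.inv_closed[of a] G(2,4) by simp
    moreover have "m a b = e" "m b a = e" using G.r_inv[of a] G.l_inv[of a] G(2,4) by auto
    ultimately show "P b"
      using G.l_one[of a] G.l_one[of b] G(2) by (auto simp: P_def)
  qed
  have "\<exists>b. Q b"
  proof -
    obtain G e where G: "G \<subseteq> S" "a \<in> G" "group \<lparr>carrier = G, monoid.mult = m, one = e\<rparr>"
      using cr a unfolding completely_regular_def subgroup_of_def is_group_on_def by blast
    \<comment> \<open>the group of units of \<open>e S e\<close>, the largest subgroup with identity \<open>e\<close>\<close>
    define U where "U = {x \<in> S. m e x = x \<and> m x e = x \<and>
      (\<exists>y\<in>S. m e y = y \<and> m y e = y \<and> m x y = e \<and> m y x = e)}"
    have sub: "K \<subseteq> U" if "K \<subseteq> S" "group \<lparr>carrier = K, monoid.mult = m, one = e\<rparr>" for K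
    proof
      fix x assume x: "x \<in> K"
      interpret K: group "\<lparr>carrier = K, monoid.mult = m, one = e\<rparr>" by fact
      obtain y where "y \<in> K" "m x y = e" "m y x = e"
        using x K.inv_closed[of x] K.r_inv[of x] K.l_inv[of x] by auto
      then show "x \<in> U"
        using x that(1) K.l_one[of x] K.r_one[of x] K.l_one[of y] K.r_one[of y]
        by (auto simp: U_def)
    qed
    interpret G: group "\<lparr>carrier = G, monoid.mult = m, one = e\<rparr>" by fact
    have e: "e \<in> S" "m e e = e" using G(1) G.one_closed G.l_one[of e] by auto
    have U: "group \<lparr>carrier = U, monoid.mult = m, one = e\<rparr>"
    proof (rule groupI, goal_cases)
      case (1 x x')
      then obtain y y' where y: "y \<in> S" "m e y = y" "m y e = y" "m x y = e" "m y x = e"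
        and y': "y' \<in> S" "m e y' = y'" "m y' e = y'" "m x' y' = e" "m y' x' = e"
        by (auto simp: U_def)
      have x: "x \<in> S" "m e x = x" "m x e = x" "x' \<in> S" "m e x' = x'" "m x' e = x'"
        using 1 by (auto simp: U_def)
      \<comment> \<open>The inverse of the product is \<open>m y' y\<close>; regrouping cancels the
        inner pair first.\<close>
      have "m (m x x') (m y' y) = m x (m (m x' y') y)" "m (m y' y) (m x x') = m y' (m (m y x) x')"
        using x y(1) y'(1) clos assoc by auto
      then have "m (m x x') (m y' y) = e" "m (m y' y) (m x x') = e"
        using x y y' by auto
      moreover have "m e (m x x') = m x x'" "m (m x x') e = m x x'"
        "m e (m y' y) = m y' y" "m (m y' y) e = m y' y"
        using x y y' e assoc by metis+
      ultimately have "m x x' \<in> U"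
        unfolding U_def using clos[OF x(1,4)] clos[OF y'(1) y(1)] by blast
      then show ?case by simp
    next
      case 5 then show ?case by (auto simp: U_def)
    qed (use e assoc in \<open>auto simp: U_def\<close>)
    have "maximal_subgroup_of U S m"
      unfolding maximal_subgroup_of_def
    proof (intro conjI allI impI)
      show "subgroup_of U S m"
        using U by (auto simp: subgroup_of_def is_group_on_def U_def)
      fix K assume K: "subgroup_of K S m \<and> U \<subseteq> K"
      then obtain f where f: "K \<subseteq> S" "group \<lparr>carrier = K, monoid.mult = m, one = f\<rparr>"
        by (auto simp: subgroup_of_def is_group_on_def)
      interpret K: group "\<lparr>carrier = K, monoid.mult = m, one = f\<rparr>" by fact
      \<comment> \<open>A larger subgroup contains the idempotent \<open>e\<close>, which must be
        its identity, and \<open>sub\<close> then puts it inside \<open>U\<close>.\<close>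
      have "e \<in> K" using K U_def e by auto
      then have "e = f" using K.l_cancel_one[of e e] e by simp
      then show "K = U" using sub f K by blast
    qed
    moreover have "a \<in> U" using sub G by blast
    ultimately show ?thesis using U unfolding Q_def by blast
  qed
  then have "Q (THE b. Q b)" using P_unique QP by (metis theI')
  moreover have "(THE b. Q b) = b"
    unfolding b_def cr_inverse_def Q_def ..
  ultimately have "P b" using QP by simp
  then show ?thesis unfolding P_def .
qed

lemma cr_semigroup_cr_inverse:
  assumes "completely_regular S m"
  shows "cr_semigroup S m (cr_inverse S m)"
proof
  show "m x y \<in> S" if "x \<in> S" "y \<in> S" for x y
    using assms that by (simp add: completely_regular_def semigroup_on_def)
  show "m (m x y) z = m x (m y z)" if "x \<in> S" "y \<in> S" "z \<in> S" for x y z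
    using assms that by (simp add: completely_regular_def semigroup_on_def)
qed (use cr_inverse_properties[OF assms] in blast)+

section \<open>The eight conditions brought together\<close>

theorem lemma2p1:
  fixes S :: "'a set" and m :: "'a \<Rightarrow> 'a \<Rightarrow> 'a" and \<rho> :: "('a \<times> 'a) set"
  assumes "completely_regular S m"
    and "orthodox_congruence S m \<rho>"
  shows "(cryptic (ker S m \<rho>) m
            \<longleftrightarrow> ker S m \<rho> \<subseteq> ker S m (greatest_idem_sep S m)) \<and>
         (cryptic (ker S m \<rho>) m
            \<longleftrightarrow> \<rho> \<inter> green_H S m = \<rho> \<inter> greatest_idem_sep S m) \<and>
         (cryptic (ker S m \<rho>) m
            \<longleftrightarrow> congruence_on S m (\<rho> \<inter> green_H S m)) \<and>
         (cryptic (ker S m \<rho>) m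
            \<longleftrightarrow> least_same_ker S m \<rho> \<subseteq> greatest_idem_sep S m) \<and>
         (cryptic (ker S m \<rho>) m
            \<longleftrightarrow> least_same_tr S m (least_same_ker S m \<rho>) = Id_on S) \<and>
         (cryptic (ker S m \<rho>) m
            \<longleftrightarrow> least_same_ker S m \<rho> \<inter> Theta S m = Id_on S) \<and>
         (cryptic (ker S m \<rho>) m
            \<longleftrightarrow> over_groups S m (least_same_ker S m \<rho>))"
proof -
  interpret cr_semigroup S m "cr_inverse S m"
    by (rule cr_semigroup_cr_inverse[OF assms(1)])
  have \<rho>: "congruence_on S m \<rho>"
    using assms(2) by (simp add: orthodox_congruence_def)
  let ?k = "least_same_ker S m \<rho>"
  have k: "congruence_on S m ?k"
    by (rule least_same_ker_properties(1)[OF \<rho>])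
  have sep: "?k \<subseteq> greatest_idem_sep S m \<longleftrightarrow> idempotent_separating S m ?k"
    using idempotent_separating_iff[OF k] greatest_idem_sep_properties(2)
      greatest_idem_sep_properties(3)[OF k] by blast
  \<comment> \<open>Orientation matters: the rules rewrite crypticity to the congruence condition,
    then to the equality of intersections, the kernel inclusion and
    \<open>?k \<subseteq> greatest_idem_sep S m\<close>. With \<open>sep\<close>, every condition
    ends as \<open>idempotent_separating S m ?k\<close>.\<close>
  note [simp] = cryptic_ker_iff[OF assms(2)] Int_greatest_idem_sep_cong_iff[OF \<rho>, symmetric]
    ker_subset_greatest_idem_sep_iff[OF \<rho>, symmetric]
    least_same_ker_subset_iff[OF \<rho>, symmetric]
  show ?thesis
    by (simp add: sep least_same_tr_eq_Id_on_iff[OF k] Int_Theta_eq_Id_on_iff[OF k refl]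
        over_groups_iff[OF k])
qed

end
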